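(* There are exactly two Skolem circles of order $5$, up to circle equivalence.
   Context: Let $C_{2m}$ be the cycle graph with vertices $v_1,\dots,v_{2m}$ in cyclic order. A Skolem circle of order $m$ is a labelling of the vertices of $C_{2m}$ by labels from $\{1,\dots,m\}$ such that each label is used exactly twice and any two vertices with the same label $s$ are at distance exactly $s$ in $C_{2m}$. Two Skolem circles are circle equivalent if one is obtained from the other by a rotation or a reflection of the cycle. *)

theory Defs
  imports Main "HOL-Library.FuncSet"
begin

text \<open>
  The vertices \<open>v\<^sub>1, \<dots>, v\<^sub>n\<close> of the cycle graph \<open>C\<^sub>n\<close> are represented by \<open>0, \<dots>, n - 1\<close>;
  a graph is given by its symmetric adjacency relation.
\<close>

definition cycle_edges :: "nat \<Rightarrow> (nat \<times> nat) set" where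
  "cycle_edges n = {(u, v). u < n \<and> v < n \<and> (v = (u + 1) mod n \<or> u = (v + 1) mod n)}"

text \<open>
  Length of a shortest walk: \<open>(u, v) \<in> E ^^ k\<close> says that there is a walk with \<open>k\<close> edges
  from \<open>u\<close> to \<open>v\<close>. Only meaningful when \<open>v\<close> is reachable from \<open>u\<close>, as is always
  the case in a cycle.
\<close>

definition graph_dist :: "('a \<times> 'a) set \<Rightarrow> 'a \<Rightarrow> 'a \<Rightarrow> nat" where
  "graph_dist E u v = (LEAST k. (u, v) \<in> E ^^ k)"

text \<open>
  Labellings are extensional functions (\<open>undefined\<close> outside the vertex set), so that distinct
  functions are distinct labellings.
\<close>

definition skolem_circles :: "nat \<Rightarrow> (nat \<Rightarrow> nat) set" where
  "skolem_circles m = {L \<in> {..<2 * m} \<rightarrow>\<^sub>E {1..m}.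
     (\<forall>s \<in> {1..m}. card {v \<in> {..<2 * m}. L v = s} = 2) \<and>
     (\<forall>u \<in> {..<2 * m}. \<forall>v \<in> {..<2 * m}. u \<noteq> v \<longrightarrow> L u = L v \<longrightarrow>
        graph_dist (cycle_edges (2 * m)) u v = L u)}"

definition rotation :: "nat \<Rightarrow> nat \<Rightarrow> nat \<Rightarrow> nat" where
  "rotation n k v = (v + k) mod n"

text \<open>The map \<open>v \<mapsto> k - v\<close> modulo \<open>n\<close>, for vertices \<open>v < n\<close>.\<close>

definition reflection :: "nat \<Rightarrow> nat \<Rightarrow> nat \<Rightarrow> nat" where
  "reflection n k v = (k + (n - v)) mod n"

definition circle_equiv :: "nat \<Rightarrow> ((nat \<Rightarrow> nat) \<times> (nat \<Rightarrow> nat)) set" where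
  "circle_equiv m = {(L, L'). L \<in> skolem_circles m \<and> L' \<in> skolem_circles m \<and>
     (\<exists>f \<in> range (rotation (2 * m)) \<union> range (reflection (2 * m)). \<forall>v < 2 * m. L' v = L (f v))}"

lemma int_rotation: "int (rotation n k v) = (int v + int k) mod int n"
  by (simp add: rotation_def zmod_int)

lemma int_reflection: "v < n \<Longrightarrow> int (reflection n k v) = (int k - int v) mod int n"
  by (simp add: reflection_def zmod_int of_nat_diff add_diff_eq)
    (metis add.commute add_diff_eq mod_add_self1)

lemma rotation_less: "v < n \<Longrightarrow> rotation n k v < n"
  and reflection_less: "v < n \<Longrightarrow> reflection n k v < n"
  by (simp_all add: rotation_def reflection_def)

lemma rotation_rotation: "rotation n j (rotation n k v) = rotation n (j + k) v"
  by (simp add: rotation_def mod_add_left_eq mod_add_right_eq ac_simps)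

lemma rotation_reflection: "rotation n j (reflection n k v) = reflection n (j + k) v"
  by (simp add: rotation_def reflection_def mod_add_left_eq mod_add_right_eq ac_simps)

lemma int_complement:
  assumes "0 < n"
  shows "int (j + (n - k mod n)) = int j + (int n - int k mod int n)"
proof -
  have "k mod n \<le> n" using assms by (simp add: less_imp_le)
  then show ?thesis by (simp only: of_nat_add of_nat_diff zmod_int)
qed

lemma reflection_rotation:
  assumes "v < n"
  shows "reflection n j (rotation n k v) = reflection n (j + (n - k mod n)) v"
proof -
  have "int (reflection n j (rotation n k v)) = (int j - int v - int k) mod int n"
    using assms by (simp add: int_reflection int_rotation rotation_less mod_diff_right_eq algebra_simps)
  moreover have "int (reflection n (j + (n - k mod n)) v) = (int j - int v - int k) mod int n"
  proof -
    have eq: "int (j + (n - k mod n)) = int j + (int n - int k mod int n)"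
      using assms by (intro int_complement) simp
    have "int (reflection n (j + (n - k mod n)) v)
        = (int j - int v - (int k mod int n) + int n) mod int n"
      using assms by (simp only: int_reflection eq) (simp add: algebra_simps)
    then show ?thesis by (simp add: mod_diff_right_eq)
  qed
  ultimately show ?thesis by linarith
qed

lemma reflection_reflection:
  assumes "v < n"
  shows "reflection n j (reflection n k v) = rotation n (j + (n - k mod n)) v"
proof -
  have "int (reflection n j (reflection n k v)) = (int j + int v - int k) mod int n"
    using assms by (simp add: int_reflection reflection_less mod_diff_right_eq algebra_simps)
  moreover have "int (rotation n (j + (n - k mod n)) v) = (int j + int v - int k) mod int n"
  proof -
    have eq: "int (j + (n - k mod n)) = int j + (int n - int k mod int n)"
      using assms by (intro int_complement) simp
    have "int (rotation n (j + (n - k mod n)) v)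
        = (int j + int v - (int k mod int n) + int n) mod int n"
      using assms by (simp only: int_rotation eq) (simp add: algebra_simps)
    then show ?thesis by (simp add: mod_diff_right_eq)
  qed
  ultimately show ?thesis by linarith
qed

lemma dihedral_comp:
  assumes "f \<in> range (rotation n) \<union> range (reflection n)"
    and "g \<in> range (rotation n) \<union> range (reflection n)"
  shows "\<exists>h \<in> range (rotation n) \<union> range (reflection n). \<forall>v < n. f (g v) = h v"
  using assms
  by (elim UnE rangeE)
    (metis UnI1 UnI2 rangeI rotation_rotation rotation_reflection reflection_rotation
      reflection_reflection)+

lemma dihedral_inverse:
  assumes "f \<in> range (rotation n) \<union> range (reflection n)"
  shows "\<exists>g \<in> range (rotation n) \<union> range (reflection n). \<forall>v < n. g v < n \<and> f (g v) = v"
  using assms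
proof (elim UnE rangeE)
  fix k assume f: "f = rotation n k"
  have "rotation n k (rotation n (n - k mod n) v) = v" if "v < n" for v
  proof -
    have "int (rotation n k (rotation n (n - k mod n) v))
        = (int v + int k - int k mod int n + int n) mod int n"
    proof -
      have "int (k + (n - k mod n)) = int k + (int n - int k mod int n)"
        using that by (intro int_complement) simp
      then show ?thesis
        by (simp only: rotation_rotation int_rotation) (simp add: algebra_simps)
    qed
    also have "\<dots> = (int v + int k - int k) mod int n"
      by (simp add: mod_diff_right_eq)
    also have "\<dots> = int v" using that by simp
    finally show ?thesis by linarith
  qed
  then show ?thesis unfolding f by (blast intro: rotation_less)
next
  fix k assume f: "f = reflection n k"
  have "reflection n k (reflection n k v) = v" if "v < n" for v
  proof -
    have "int (reflection n k (reflection n k v)) = (int k - (int k - int v)) mod int n"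
      using that by (simp only: int_reflection reflection_less mod_diff_right_eq)
    then show ?thesis using that by simp
  qed
  then show ?thesis unfolding f by (blast intro: reflection_less)
qed

lemma equiv_circle_equiv: "equiv (skolem_circles m) (circle_equiv m)"
proof (rule equivI)
  show "circle_equiv m \<subseteq> skolem_circles m \<times> skolem_circles m"
    by (auto simp: circle_equiv_def)
  show "refl_on (skolem_circles m) (circle_equiv m)"
  proof (rule refl_onI)
    fix L assume "L \<in> skolem_circles m"
    moreover have "\<forall>v < 2 * m. L v = L (rotation (2 * m) 0 v)"
      by (simp add: rotation_def)
    ultimately show "(L, L) \<in> circle_equiv m"
      unfolding circle_equiv_def by blast
  qed
  show "sym (circle_equiv m)"
  proof (rule symI)
    fix L L' assume "(L, L') \<in> circle_equiv m"
    then obtain f where L: "L \<in> skolem_circles m" "L' \<in> skolem_circles m"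
      and f: "f \<in> range (rotation (2 * m)) \<union> range (reflection (2 * m))"
      and eq: "\<forall>v < 2 * m. L' v = L (f v)"
      by (auto simp only: circle_equiv_def mem_Collect_eq split: prod.splits)
    from dihedral_inverse[OF f] obtain g
      where g: "g \<in> range (rotation (2 * m)) \<union> range (reflection (2 * m))"
        and "\<forall>v < 2 * m. g v < 2 * m \<and> f (g v) = v"
      by blast
    with eq have "\<forall>v < 2 * m. L v = L' (g v)" by simp
    with L g show "(L', L) \<in> circle_equiv m"
      unfolding circle_equiv_def by blast
  qed
  show "trans (circle_equiv m)"
  proof (rule transI)
    fix L1 L2 L3 assume "(L1, L2) \<in> circle_equiv m" "(L2, L3) \<in> circle_equiv m"
    then obtain f g where L: "L1 \<in> skolem_circles m" "L3 \<in> skolem_circles m"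
      and f: "f \<in> range (rotation (2 * m)) \<union> range (reflection (2 * m))"
      and g: "g \<in> range (rotation (2 * m)) \<union> range (reflection (2 * m))"
      and eq: "\<forall>v < 2 * m. L2 v = L1 (f v)" "\<forall>v < 2 * m. L3 v = L2 (g v)"
      by (auto simp only: circle_equiv_def mem_Collect_eq split: prod.splits)
    have less: "g v < 2 * m" if "v < 2 * m" for v
      using g that rotation_less reflection_less by auto
    from dihedral_comp[OF f g] obtain h
      where h: "h \<in> range (rotation (2 * m)) \<union> range (reflection (2 * m))"
        and "\<forall>v < 2 * m. f (g v) = h v"
      by blast
    with eq less have "\<forall>v < 2 * m. L3 v = L1 (h v)" by simp
    with L h show "(L1, L3) \<in> circle_equiv m"
      unfolding circle_equiv_def by blast
  qed
qed

end

theory Submission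
  imports Defs
begin

text \<open>
  Two vertices of \<open>C\<^bsub>2m\<^esub>\<close> have distance \<open>s \<le> m\<close> iff they are \<open>p\<close> and \<open>p + s\<close> modulo \<open>2m\<close> for
  some \<open>p\<close>. So a Skolem circle amounts to a partition of the vertices into such pairs, one for each
  \<open>s\<close>. For \<open>m = 5\<close> one rotates the antipodal pair labelled \<open>5\<close> to \<open>{0, 5}\<close>; placing the other
  pairs then leaves eight labellings, in two dihedral classes of four. A rotation or reflection
  only depends on its parameter modulo \<open>10\<close>, so ten values suffice to separate the classes.
\<close>

section \<open>Distances in the cycle graph\<close>

text \<open>Each edge changes the vertex by 1 or -1 modulo \<open>n\<close>, so \<open>k\<close>
  edges add up to a net displacement of absolute value at most \<open>k\<close>. This supplies the
  lower bound on distances.\<close>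

lemma cycle_walk_offset:
  assumes "(u, v) \<in> cycle_edges n ^^ k"
  shows "\<exists>j. \<bar>j\<bar> \<le> int k \<and> int n dvd int v - int u - j"
  using assms
proof (induction k arbitrary: v)
  case 0
  then show ?case by (intro exI[of _ 0]) auto
next
  case (Suc k)
  then obtain w where "(u, w) \<in> cycle_edges n ^^ k" and e: "(w, v) \<in> cycle_edges n"
    by auto
  with Suc.IH obtain j where j: "\<bar>j\<bar> \<le> int k" "int n dvd int w - int u - j" by blast
  from e have "int n dvd int v - int w - 1 \<or> int n dvd int v - int w + 1"
  proof (simp add: cycle_edges_def, elim conjE disjE)
    assume "v = Suc w mod n"
    then have "int v = (int w + 1) mod int n" by (simp add: zmod_int add.commute)
    then have "int v mod int n = (int w + 1) mod int n" by simp
    then show ?thesis by (simp add: mod_eq_dvd_iff algebra_simps)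
  next
    assume "w = Suc v mod n"
    then have "int w = (int v + 1) mod int n" by (simp add: zmod_int add.commute)
    then have "(int v + 1) mod int n = int w mod int n" by simp
    then show ?thesis by (simp add: mod_eq_dvd_iff algebra_simps)
  qed
  then obtain d where d: "\<bar>d\<bar> = 1" "int n dvd int v - int w - d"
    by (metis abs_minus_cancel abs_one diff_minus_eq_add)
  have "int n dvd int v - int u - (j + d)"
    using dvd_add[OF j(2) d(2)] by (simp add: algebra_simps)
  with j d show ?case by (intro exI[of _ "j + d"]) auto
qed

lemma cycle_walk_forward: "u < n \<Longrightarrow> (u, (u + k) mod n) \<in> cycle_edges n ^^ k"
proof (induction k)
  case (Suc k)
  have "((u + k) mod n, (u + Suc k) mod n) \<in> cycle_edges n"
    using Suc.prems by (auto simp: cycle_edges_def mod_Suc_eq)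
  with Suc show ?case by auto
qed simp

lemma cycle_walk_backward: "u < n \<Longrightarrow> ((u + k) mod n, u) \<in> cycle_edges n ^^ k"
proof (induction k)
  case (Suc k)
  have "((u + Suc k) mod n, (u + k) mod n) \<in> cycle_edges n"
    using Suc.prems by (auto simp: cycle_edges_def mod_Suc_eq)
  with Suc show ?case by (blast intro: relpow_Suc_I2)
qed simp

lemma graph_dist_cycle:
  assumes "p < n" "2 * s \<le> n"
  shows "graph_dist (cycle_edges n) p ((p + s) mod n) = s"
    and "graph_dist (cycle_edges n) ((p + s) mod n) p = s"
proof -
  define q where "q = (p + s) mod n"
  have "int q mod int n = (int p + int s) mod int n"
    by (simp add: q_def zmod_int)
  then have q: "int n dvd int q - (int p + int s)" by (simp add: mod_eq_dvd_iff)
  \<comment> \<open>If \<open>k < s\<close>, then \<open>0 < s + j < 2 * s \<le> n\<close>, which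
    leaves no room for a multiple of \<open>n\<close>. Both directions reduce to this, with
    displacement \<open>- j\<close> or \<open>j\<close>.\<close>
  have far: "s \<le> k" if "int n dvd int s + j" "\<bar>j\<bar> \<le> int k" for j k
  proof (rule ccontr)
    assume "\<not> s \<le> k"
    then have "0 < int s + j" "int s + j < int n" using that assms by linarith+
    with that(1) show False using zdvd_not_zless by blast
  qed
  have "s \<le> k" if "(p, q) \<in> cycle_edges n ^^ k" for k
  proof -
    from cycle_walk_offset[OF that] obtain j
      where j: "\<bar>j\<bar> \<le> int k" "int n dvd int q - int p - j" by blast
    have "int n dvd int s + - j" using dvd_diff[OF j(2) q] by (simp add: algebra_simps)
    then show ?thesis using j(1) by (intro far[of "- j"]) auto
  qed
  then show "graph_dist (cycle_edges n) p ((p + s) mod n) = s"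
    unfolding graph_dist_def q_def[symmetric]
    using cycle_walk_forward[OF assms(1), of s] by (intro Least_equality) (auto simp: q_def)
  have "s \<le> k" if "(q, p) \<in> cycle_edges n ^^ k" for k
  proof -
    from cycle_walk_offset[OF that] obtain j
      where j: "\<bar>j\<bar> \<le> int k" "int n dvd int p - int q - j" by blast
    have "int n dvd - (int s + j)" using dvd_add[OF j(2) q] by (simp add: algebra_simps)
    then have "int n dvd int s + j" by (simp only: dvd_minus_iff)
    then show ?thesis using j(1) by (intro far)
  qed
  then show "graph_dist (cycle_edges n) ((p + s) mod n) p = s"
    unfolding graph_dist_def q_def[symmetric]
    using cycle_walk_backward[OF assms(1), of s] by (intro Least_equality) (auto simp: q_def)
qed

text \<open>The two ways around the cycle have lengths \<open>b - a\<close> and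
  \<open>n - (b - a)\<close>; one of them is at most half of \<open>n\<close>. Which endpoint the
  offset starts from depends on which way is shorter.\<close>

lemma cycle_offset_cases:
  fixes u v n :: nat
  assumes "u < n" "v < n"
  obtains s where "2 * s \<le> n" "v = (u + s) mod n"
  | s where "2 * s \<le> n" "u = (v + s) mod n"
proof -
  have "\<exists>s. 2 * s \<le> n \<and> (b = (a + s) mod n \<or> a = (b + s) mod n)"
    if "a \<le> b" "b < n" for a b
  proof (cases "2 * (b - a) \<le> n")
    case True
    with that show ?thesis by (intro exI[of _ "b - a"]) auto
  next
    case False
    with that have "b + (n - (b - a)) = a + n" by linarith
    with that have "a = (b + (n - (b - a))) mod n" by simp
    with False show ?thesis by (intro exI[of _ "n - (b - a)"]) auto
  qed
  with assms that show thesis by (metis nat_le_linear)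
qed

section \<open>Skolem circles as partitions into pairs, and their rotations\<close>

text \<open>This trades cardinalities and graph distances for explicit fibres. Forwards, two
  vertices with label \<open>s\<close> differ by some offset \<open>t \<le> m\<close>, and
  \<open>t\<close> is then their distance, so \<open>t = s\<close>. Backwards, the fibre has two
  elements because \<open>0 < s < 2 * m\<close>.\<close>

lemma skolem_circles_iff:
  "L \<in> skolem_circles m \<longleftrightarrow> L \<in> {..<2 * m} \<rightarrow>\<^sub>E {1..m} \<and>
     (\<forall>s\<in>{1..m}. \<exists>p<2 * m. {v \<in> {..<2 * m}. L v = s} = {p, (p + s) mod (2 * m)})"
  (is "_ \<longleftrightarrow> ?F \<and> (\<forall>s\<in>_. ?P s)")
proof
  assume L: "L \<in> skolem_circles m"
  have "?P s" if "s \<in> {1..m}" for s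
  proof -
    from L that have "card {v \<in> {..<2 * m}. L v = s} = 2" by (simp add: skolem_circles_def)
    then obtain x y where xy: "{v \<in> {..<2 * m}. L v = s} = {x, y}" "x \<noteq> y"
      by (auto simp: card_2_iff)
    then have lt: "x < 2 * m" "y < 2 * m" and lab: "L x = s" "L y = s" by auto
    with L xy(2) have dist: "graph_dist (cycle_edges (2 * m)) x y = s"
      by (auto simp: skolem_circles_def)
    show ?thesis
      using lt
    proof (cases rule: cycle_offset_cases)
      case (1 t)
      then have "t = s" using graph_dist_cycle(1)[OF lt(1)] dist by metis
      with 1 lt xy(1) show ?thesis by blast
    next
      case (2 t)
      then have "t = s" using graph_dist_cycle(2)[OF lt(2)] dist by metis
      with 2 lt xy(1) show ?thesis by blast
    qed
  qed
  with L show "?F \<and> (\<forall>s\<in>{1..m}. ?P s)" by (simp add: skolem_circles_def)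
next
  assume R: "?F \<and> (\<forall>s\<in>{1..m}. ?P s)"
  have "card {v \<in> {..<2 * m}. L v = s} = 2" if s: "s \<in> {1..m}" for s
  proof -
    from R s obtain p where p: "p < 2 * m"
      and fib: "{v \<in> {..<2 * m}. L v = s} = {p, (p + s) mod (2 * m)}" by blast
    have "p \<noteq> (p + s) mod (2 * m)"
      using p s by (cases "p + s < 2 * m") (auto simp: le_mod_geq)
    with fib show ?thesis by simp
  qed
  moreover have "graph_dist (cycle_edges (2 * m)) u v = L u"
    if uv: "u < 2 * m" "v < 2 * m" "u \<noteq> v" "L u = L v" for u v
  proof -
    from R uv have s: "L u \<in> {1..m}" by auto
    with R obtain p where p: "p < 2 * m"
      and fib: "{w \<in> {..<2 * m}. L w = L u} = {p, (p + L u) mod (2 * m)}" by blast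
    from uv have "u \<in> {p, (p + L u) mod (2 * m)}" "v \<in> {p, (p + L u) mod (2 * m)}"
      unfolding fib[symmetric] by auto
    then have "u = p \<and> v = (p + L u) mod (2 * m) \<or> u = (p + L u) mod (2 * m) \<and> v = p"
      using uv(3) by auto
    moreover have "2 * L u \<le> 2 * m" using s by simp
    ultimately show ?thesis using graph_dist_cycle[OF p] by metis
  qed
  ultimately show "L \<in> skolem_circles m" using R by (auto simp: skolem_circles_def)
qed

lemma rotation_inverse:
  assumes "v < n"
  shows "rotation n k (rotation n (n - k mod n) v) = v"
    and "rotation n (n - k mod n) (rotation n k v) = v"
proof -
  have "(k + (n - k mod n)) mod n = 0"
    using assms by (metis add_diff_inverse_nat less_imp_le mod_add_left_eq mod_less_divisor
      mod_self not_less_iff_gr_or_eq gr_implies_not0 bot_nat_0.not_eq_extremum)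
  then have "(v + (k + (n - k mod n))) mod n = v"
    using assms by (metis add.right_neutral mod_add_right_eq mod_less)
  then show "rotation n k (rotation n (n - k mod n) v) = v"
    "rotation n (n - k mod n) (rotation n k v) = v"
    by (simp_all add: rotation_rotation) (simp_all add: rotation_def add.commute)
qed

text \<open>Rotations commute with adding \<open>s\<close> modulo \<open>2 * m\<close>, so the
  inverse rotation \<open>r\<close> carries each fibre to a pair of the same form. The
  \<open>restrict\<close> keeps the labelling extensional.\<close>

lemma rotation_skolem_circle:
  assumes "L \<in> skolem_circles m"
  shows "restrict (\<lambda>v. L (rotation (2 * m) k v)) {..<2 * m} \<in> skolem_circles m" (is "?L \<in> _")
  unfolding skolem_circles_iff
proof (intro conjI ballI)
  let ?n = "2 * m"
  define r where "r = rotation ?n (?n - k mod ?n)"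
  have L: "L \<in> {..<?n} \<rightarrow>\<^sub>E {1..m}" using assms by (simp add: skolem_circles_def)
  show "?L \<in> {..<?n} \<rightarrow>\<^sub>E {1..m}"
    using L rotation_less[of _ ?n k] by (auto simp: PiE_iff)
  fix s assume "s \<in> {1..m}"
  with assms obtain p where p: "p < ?n" "{v \<in> {..<?n}. L v = s} = {p, (p + s) mod ?n}"
    unfolding skolem_circles_iff by blast
  have "{v \<in> {..<?n}. ?L v = s} = r ` {v \<in> {..<?n}. L v = s}"
  proof (intro set_eqI iffI)
    fix v assume "v \<in> {v \<in> {..<?n}. ?L v = s}"
    then show "v \<in> r ` {v \<in> {..<?n}. L v = s}"
      by (intro image_eqI[of _ _ "rotation ?n k v"])
        (auto simp: r_def rotation_inverse rotation_less)
  qed (auto simp: r_def rotation_inverse rotation_less)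
  also have "\<dots> = {r p, (r p + s) mod ?n}"
    unfolding p(2) by (simp add: r_def rotation_def mod_simps ac_simps)
  finally show "\<exists>p<?n. {v \<in> {..<?n}. ?L v = s} = {p, (p + s) mod ?n}"
    using p(1) rotation_less by (auto simp: r_def)
qed

lemma rotation_circle_equiv:
  assumes "L \<in> skolem_circles m"
  shows "(L, restrict (\<lambda>v. L (rotation (2 * m) k v)) {..<2 * m}) \<in> circle_equiv m"
  using assms rotation_skolem_circle[OF assms, of k] by (auto simp: circle_equiv_def)

section \<open>The two representatives and their inequivalence\<close>

definition labelling_of_list :: "nat list \<Rightarrow> nat \<Rightarrow> nat" where
  "labelling_of_list l = restrict (nth l) {..<length l}"

lemma labelling_of_list_nth: "v < length l \<Longrightarrow> labelling_of_list l v = l ! v"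
  by (simp add: labelling_of_list_def)

text \<open>Representatives of the two classes, both with label 5 at 0 and 5 and label 4 at 2 and
  6.\<close>

abbreviation circle_A :: "nat list" where "circle_A \<equiv> [5, 2, 4, 2, 3, 5, 4, 3, 1, 1]"
abbreviation circle_B :: "nat list" where "circle_B \<equiv> [5, 3, 4, 1, 1, 5, 4, 2, 3, 2]"

text \<open>A form of \<open>skolem_circles_iff\<close> that can be evaluated on a concrete list.
  Both orders of the pair are allowed because \<open>filter\<close> lists vertices increasingly,
  while \<open>p + s\<close> may wrap around.\<close>

lemma labelling_of_list_skolem:
  assumes "length l = 2 * m" "set l \<subseteq> {1..m}"
    and "\<forall>s\<in>set [1..<Suc m]. \<exists>p\<in>set [0..<2 * m].
      filter (\<lambda>v. l ! v = s) [0..<2 * m] \<in> {[p, (p + s) mod (2 * m)], [(p + s) mod (2 * m), p]}"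
  shows "labelling_of_list l \<in> skolem_circles m"
  unfolding skolem_circles_iff
proof (intro conjI ballI)
  show "labelling_of_list l \<in> {..<2 * m} \<rightarrow>\<^sub>E {1..m}"
    using assms(1,2) by (auto simp: labelling_of_list_def subset_iff)
  fix s assume "s \<in> {1..m}"
  then have "s \<in> set [1..<Suc m]" by auto
  with assms(3) obtain p where p: "p < 2 * m"
    and F: "filter (\<lambda>v. l ! v = s) [0..<2 * m] \<in>
      {[p, (p + s) mod (2 * m)], [(p + s) mod (2 * m), p]}"
    by fastforce
  from F have "set (filter (\<lambda>v. l ! v = s) [0..<2 * m]) = {p, (p + s) mod (2 * m)}"
    by (elim insertE emptyE) (simp_all only: list.set insert_commute)
  moreover have "{v \<in> {..<2 * m}. labelling_of_list l v = s} =
      set (filter (\<lambda>v. l ! v = s) [0..<2 * m])"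
    using assms(1) by (auto simp: labelling_of_list_def)
  ultimately show "\<exists>p<2 * m. {v \<in> {..<2 * m}. labelling_of_list l v = s} =
      {p, (p + s) mod (2 * m)}"
    using p by auto
qed

lemma circle_A_skolem: "labelling_of_list circle_A \<in> skolem_circles 5"
  by (rule labelling_of_list_skolem; code_simp)

lemma circle_B_skolem: "labelling_of_list circle_B \<in> skolem_circles 5"
  by (rule labelling_of_list_skolem; code_simp)

lemma dihedral_mod: "rotation n (k mod n) = rotation n k" "reflection n (k mod n) = reflection n k"
  by (auto simp: rotation_def reflection_def mod_simps)

lemma circle_A_B_not_equiv:
  "(labelling_of_list circle_A, labelling_of_list circle_B) \<notin> circle_equiv 5"
proof
  assume "(labelling_of_list circle_A, labelling_of_list circle_B) \<in> circle_equiv 5"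
  then obtain f where f: "f \<in> range (rotation 10) \<union> range (reflection 10)"
    and eq: "\<forall>v<10. labelling_of_list circle_B v = labelling_of_list circle_A (f v)"
    by (auto simp: circle_equiv_def)
  from f have "\<exists>k<10. f = rotation 10 k \<or> f = reflection 10 k"
    by (elim UnE rangeE) (metis dihedral_mod mod_less_divisor zero_less_numeral)+
  then obtain k where "k < 10" and k: "f = rotation 10 k \<or> f = reflection 10 k" by blast
  from f have "f v < 10" if "v < 10" for v using that rotation_less reflection_less by auto
  moreover have "length circle_A = 10" "length circle_B = 10" by simp_all
  ultimately have eq': "\<forall>v\<in>set [0..<10]. circle_B ! v = circle_A ! f v"
    using eq by (metis atLeast0LessThan lessThan_iff labelling_of_list_nth set_upt)
  \<comment> \<open>Only twenty maps remain, and evaluation refutes each of them.\<close>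
  have "\<forall>k\<in>set [0..<10]. \<not> (\<forall>v\<in>set [0..<10]. circle_B ! v = circle_A ! rotation 10 k v) \<and>
      \<not> (\<forall>v\<in>set [0..<10]. circle_B ! v = circle_A ! reflection 10 k v)"
    by code_simp
  moreover have "k \<in> set [0..<10]" using \<open>k < 10\<close> by simp
  ultimately show False using k eq' by blast
qed

section \<open>Enumeration of the labellings with label 5 at 0 and 5\<close>

text \<open>The variables \<open>a\<close>, \<open>b\<close>, \<open>c\<close>, \<open>d\<close> are
  the starting points of the pairs labelled 4, 3, 2, 1. The nested tests discard a partial placement
  as soon as two pairs overlap.\<close>

lemma placements:
  "\<forall>a\<in>set [0..<10]. if distinct [0, 5, a, (a + 4) mod 10] then
    (\<forall>b\<in>set [0..<10]. if distinct [0, 5, a, (a + 4) mod 10, b, (b + 3) mod 10] then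
      (\<forall>c\<in>set [0..<10].
        if distinct [0, 5, a, (a + 4) mod 10, b, (b + 3) mod 10, c, (c + 2) mod 10] then
        (\<forall>d\<in>set [0..<10].
          if distinct [0, 5, a, (a + 4) mod 10, b, (b + 3) mod 10, c, (c + 2) mod 10,
            d, (d + 1) mod 10]
          then (a, b, c, d) \<in> set [(2, 4, 1, 8), (2, 8, 7, 3), (4, 3, 7, 1), (4, 9, 1, 6),
            (7, 3, 2, 8), (7, 9, 6, 3), (9, 4, 6, 1), (9, 8, 2, 6)]
          else True)
        else True)
      else True)
    else (True::bool)"
  by code_simp

text \<open>The dihedral maps preserving \<open>{0, 5}\<close> are the rotations and reflections
  with parameter 0 or 5. Applied to the two representatives, these four maps produce exactly the
  eight placements.\<close>

lemma normalized_circle_equiv: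
  assumes L: "L \<in> skolem_circles 5" and L05: "L 0 = 5" "L 5 = 5"
  shows "\<exists>l\<in>{circle_A, circle_B}. (labelling_of_list l, L) \<in> circle_equiv 5"
proof -
  have fib: "\<exists>p<10. {v \<in> {..<10}. L v = s} = {p, (p + s) mod 10}" if "s \<in> {1..5}" for s
    using L that unfolding skolem_circles_iff by auto
  have pos: "\<exists>p\<in>set [0..<10]. L p = s \<and> L ((p + s) mod 10) = s" if s: "s \<in> {1..5}" for s
  proof -
    from fib[OF s] obtain p where "p < 10" "{v \<in> {..<10}. L v = s} = {p, (p + s) mod 10}" by blast
    then have "p \<in> set [0..<10]" "L p = s" "L ((p + s) mod 10) = s" by auto
    then show ?thesis by blast
  qed
  obtain a where a: "a \<in> set [0..<10]" "L a = 4" "L ((a + 4) mod 10) = 4" using pos[of 4] by auto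
  obtain b where b: "b \<in> set [0..<10]" "L b = 3" "L ((b + 3) mod 10) = 3" using pos[of 3] by auto
  obtain c where c: "c \<in> set [0..<10]" "L c = 2" "L ((c + 2) mod 10) = 2" using pos[of 2] by auto
  obtain d where d: "d \<in> set [0..<10]" "L d = 1" "L ((d + 1) mod 10) = 1" using pos[of 1] by auto
  have ne: "p \<noteq> (p + s) mod 10" if "p \<in> set [0..<10]" "s \<in> {1..5}" for p s :: nat
    using that by (cases "p + s < 10") (auto simp: le_mod_geq)
  have diff: "u \<noteq> v" if "L u \<noteq> L v" for u v using that by auto
  \<comment> \<open>The two ends of one pair differ because \<open>0 < s < 10\<close>; vertices of
    different pairs differ because their labels do.\<close>
  have dist: "distinct [0, 5, a, (a + 4) mod 10, b, (b + 3) mod 10, c, (c + 2) mod 10,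
      d, (d + 1) mod 10]"
    unfolding distinct.simps list.set insert_iff de_Morgan_disj
    by (intro conjI;
        ((rule ne[OF a(1)] ne[OF b(1)] ne[OF c(1)] ne[OF d(1)]; simp; fail)
        | (rule diff; simp only: L05 a(2,3) b(2,3) c(2,3) d(2,3); simp; fail) | simp))
  have abcd: "(a, b, c, d) \<in> set [(2, 4, 1, 8), (2, 8, 7, 3), (4, 3, 7, 1), (4, 9, 1, 6),
      (7, 3, 2, 8), (7, 9, 6, 3), (9, 4, 6, 1), (9, 8, 2, 6)]"
  proof -
    \<comment> \<open>Together with \<open>dist\<close>, one fact for each nested test in
      \<open>placements\<close>.\<close>
    have "distinct [0, 5, a, (a + 4) mod 10, b, (b + 3) mod 10, c, (c + 2) mod 10]"
      "distinct [0, 5, a, (a + 4) mod 10, b, (b + 3) mod 10]"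
      "distinct [0, 5, a, (a + 4) mod 10]"
      using dist by (simp_all only: distinct.simps set_simps insert_iff) blast+
    with dist placements a(1) b(1) c(1) d(1) show ?thesis by metis
  qed
  \<comment> \<open>This reduces each of the eight cases to an equality of two explicit lists of ten
    labels.\<close>
  have equiv: "\<exists>l\<in>{circle_A, circle_B}. (labelling_of_list l, L) \<in> circle_equiv 5"
    if "l \<in> {circle_A, circle_B}" "k \<in> {0, 5}" "f = rotation 10 k \<or> f = reflection 10 k"
      and "map L [0..<10] = map (\<lambda>v. l ! f v) [0..<10]" for l f k
  proof -
    have "f v < 10" if "v < 10" for v
      using \<open>f = _ \<or> f = _\<close> that rotation_less reflection_less by auto
    moreover have "length l = 10" using that(1) by auto
    ultimately have "\<forall>v<2 * 5. L v = labelling_of_list l (f v)"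
      using that(4) by (simp add: labelling_of_list_nth)
    moreover have "f \<in> range (rotation (2 * 5)) \<union> range (reflection (2 * 5))" using that by auto
    moreover have "labelling_of_list l \<in> skolem_circles 5"
      using that(1) circle_A_skolem circle_B_skolem by blast
    ultimately have "(labelling_of_list l, L) \<in> circle_equiv 5"
      using L unfolding circle_equiv_def by blast
    with that(1) show ?thesis by blast
  qed
  have "[0..<10] = [0, 1, 2, 3, 4, 5, 6, 7, 8, 9]" by code_simp
  note eval = this rotation_def reflection_def L05 numeral_2_eq_2[symmetric]
  from abcd consider "(a, b, c, d) = (2, 4, 1, 8)" | "(a, b, c, d) = (2, 8, 7, 3)"
    | "(a, b, c, d) = (4, 3, 7, 1)" | "(a, b, c, d) = (4, 9, 1, 6)" | "(a, b, c, d) = (7, 3, 2, 8)"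
    | "(a, b, c, d) = (7, 9, 6, 3)" | "(a, b, c, d) = (9, 4, 6, 1)" | "(a, b, c, d) = (9, 8, 2, 6)"
    unfolding list.set by (elim insertE emptyE) simp_all
  then show ?thesis
  \<comment> \<open>Composing with \<open>rotation 10 k\<close> moves the start \<open>p\<close> of
    the pair labelled \<open>s\<close> to \<open>p - k\<close> modulo 10, and composing with
    \<open>reflection 10 k\<close> moves it to \<open>k - p - s\<close>. This determines the
    representative and the map in each case.\<close>
  proof cases
    case 1
    with a(2,3) b(2,3) c(2,3) d(2,3) show ?thesis by (intro equiv[of circle_A 0 "rotation 10 0"]) (simp_all add: eval del: map_eq_conv)
  next
    case 2
    with a(2,3) b(2,3) c(2,3) d(2,3) show ?thesis by (intro equiv[of circle_B 0 "rotation 10 0"]) (simp_all add: eval del: map_eq_conv)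
  next
    case 3
    with a(2,3) b(2,3) c(2,3) d(2,3) show ?thesis by (intro equiv[of circle_A 0 "reflection 10 0"]) (simp_all add: eval del: map_eq_conv)
  next
    case 4
    with a(2,3) b(2,3) c(2,3) d(2,3) show ?thesis by (intro equiv[of circle_B 0 "reflection 10 0"]) (simp_all add: eval del: map_eq_conv)
  next
    case 5
    with a(2,3) b(2,3) c(2,3) d(2,3) show ?thesis by (intro equiv[of circle_B 5 "rotation 10 5"]) (simp_all add: eval del: map_eq_conv)
  next
    case 6
    with a(2,3) b(2,3) c(2,3) d(2,3) show ?thesis by (intro equiv[of circle_A 5 "rotation 10 5"]) (simp_all add: eval del: map_eq_conv)
  next
    case 7
    with a(2,3) b(2,3) c(2,3) d(2,3) show ?thesis by (intro equiv[of circle_B 5 "reflection 10 5"]) (simp_all add: eval del: map_eq_conv)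
  next
    case 8
    with a(2,3) b(2,3) c(2,3) d(2,3) show ?thesis by (intro equiv[of circle_A 5 "reflection 10 5"]) (simp_all add: eval del: map_eq_conv)
  qed
qed

section \<open>Counting the classes\<close>

theorem theorem13:
  shows "card (skolem_circles 5 // circle_equiv 5) = 2"
proof -
  let ?A = "labelling_of_list circle_A" and ?B = "labelling_of_list circle_B"
  let ?r = "circle_equiv 5"
  note eq = equiv_circle_equiv[of 5]
  have ex: "(?A, L) \<in> ?r \<or> (?B, L) \<in> ?r" if L: "L \<in> skolem_circles 5" for L
  proof -
    from L obtain p where p: "p < 10" "{v \<in> {..<10}. L v = 5} = {p, (p + 5) mod 10}"
      unfolding skolem_circles_iff by (force dest: bspec[of _ _ 5])
    then have "L p = 5" "L ((p + 5) mod 10) = 5" by auto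
    \<comment> \<open>Since \<open>M v\<close> is \<open>L\<close> at \<open>v + p\<close> modulo
      10, the pair labelled 5 starting at \<open>p\<close> moves to \<open>{0, 5}\<close>.\<close>
    define M where "M = restrict (\<lambda>v. L (rotation (2 * 5) p v)) {..<2 * 5}"
    have "M 0 = 5" "M 5 = 5"
      using p \<open>L p = 5\<close> \<open>L ((p + 5) mod 10) = 5\<close>
      by (simp_all add: M_def rotation_def add.commute)
    then have "(?A, M) \<in> ?r \<or> (?B, M) \<in> ?r"
      using normalized_circle_equiv[of M] rotation_skolem_circle[OF L] by (simp add: M_def)
    moreover have "(M, L) \<in> ?r"
      using rotation_circle_equiv[OF L, of p] eq unfolding M_def by (blast elim: equivE dest: symD)
    ultimately show ?thesis using eq by (blast elim: equivE dest: transD)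
  qed
  have "skolem_circles 5 // ?r = {?r `` {?A}, ?r `` {?B}}"
  proof (intro equalityI subsetI)
    fix X assume "X \<in> skolem_circles 5 // ?r"
    then obtain L where "L \<in> skolem_circles 5" "X = ?r `` {L}" by (rule quotientE)
    with ex[of L] equiv_class_eq[OF eq, of ?A L] equiv_class_eq[OF eq, of ?B L]
    show "X \<in> {?r `` {?A}, ?r `` {?B}}" by auto
  qed (use circle_A_skolem circle_B_skolem in \<open>auto intro: quotientI\<close>)
  moreover have "?r `` {?A} \<noteq> ?r `` {?B}"
    using circle_A_B_not_equiv eq_equiv_class[OF _ eq circle_B_skolem] by blast
  ultimately show ?thesis by simp
qed

end
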